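(* Let $A\in\mathbb{R}^{d\times d}$ be symmetric and $b\in\mathbb{R}^d$ with $b^{(1)}\ne0$. Consider either of the following. (TR) $R>0$; the problem is to minimize $f(x)=\frac12x^TAx+b^Tx$ over $\|x\|\le R$; the iterates are $x_{t+1}=\Pi_R(x_t-\eta(Ax_t+b))$ with $x_0=-r\,b/\|b\|$, $r\in[0,R]$, and $0<\eta\le\frac1\beta$. (CR) $\rho>0$; the problem is to minimize $f(x)=\frac12x^TAx+b^Tx+\frac\rho3\|x\|^3$ over $\mathbb{R}^d$; the iterates are $x_{t+1}=x_t-\eta(Ax_t+b+\rho\|x_t\|x_t)$ with $x_0=-r\,b/\|b\|$, $r\in[0,R_c]$, and $0<\eta\le\frac{1}{4(\beta+\rho R_\rho)}$. In either case let $x_\star$ be a solution of the corresponding problem. Then $x_t\to x_\star$ as $t\to\infty$, and the objective is monotone decreasing along the iterates: $f(x_{t+1})\le f(x_t)$ for all $t\ge0$.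
   Context: $\|\cdot\|$ is the Euclidean norm (operator norm for matrices). $\Pi_R$ is Euclidean projection onto $\{x:\|x\|\le R\}$. $b^{(1)}=v_1^Tb$, where $v_1$ is a unit eigenvector of $A$ for its smallest eigenvalue. $\beta$ is $\|A\|$, or any number with $\beta\ge\|A\|$ (if $\beta=0$, $1/\beta$ is read as $+\infty$). The constants are $$R_\rho=\frac{\beta}{2\rho}+\sqrt{\left(\frac{\beta}{2\rho}\right)^2+\frac{\|b\|}{\rho}},\qquad R_c=\frac{-b^TAb}{2\rho\|b\|^2}+\sqrt{\left(\frac{b^TAb}{2\rho\|b\|^2}\right)^2+\frac{\|b\|}{\rho}}.$$ *)

theory Defs
  imports "HOL-Analysis.Analysis"
begin

definition eigenvalue :: "real^'n^'n \<Rightarrow> real \<Rightarrow> bool" where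
  "eigenvalue A l \<longleftrightarrow> (\<exists>v. v \<noteq> 0 \<and> A *v v = l *\<^sub>R v)"

definition smallest_eigenvalue :: "real^'n^'n \<Rightarrow> real \<Rightarrow> bool" where
  "smallest_eigenvalue A l \<longleftrightarrow> eigenvalue A l \<and> (\<forall>m. eigenvalue A m \<longrightarrow> l \<le> m)"

definition unit_min_eigenvector :: "real^'n^'n \<Rightarrow> real^'n \<Rightarrow> bool" where
  "unit_min_eigenvector A v \<longleftrightarrow>
     norm v = 1 \<and> (\<exists>l. smallest_eigenvalue A l \<and> A *v v = l *\<^sub>R v)"

(* The norm of the type real^'n^'n is the Frobenius norm, hence onorm here. *)
definition op_norm :: "real^'n^'n \<Rightarrow> real" where
  "op_norm A = onorm ((*v) A)"

definition tr_obj :: "real^'n^'n \<Rightarrow> real^'n \<Rightarrow> real^'n \<Rightarrow> real" where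
  "tr_obj A b x = 1/2 * (x \<bullet> (A *v x)) + b \<bullet> x"

definition cr_obj :: "real^'n^'n \<Rightarrow> real^'n \<Rightarrow> real \<Rightarrow> real^'n \<Rightarrow> real" where
  "cr_obj A b \<rho> x = 1/2 * (x \<bullet> (A *v x)) + b \<bullet> x + \<rho>/3 * norm x ^ 3"

definition tr_solution :: "real^'n^'n \<Rightarrow> real^'n \<Rightarrow> real \<Rightarrow> real^'n \<Rightarrow> bool" where
  "tr_solution A b R x \<longleftrightarrow> is_arg_min (tr_obj A b) (\<lambda>y. norm y \<le> R) x"

definition cr_solution :: "real^'n^'n \<Rightarrow> real^'n \<Rightarrow> real \<Rightarrow> real^'n \<Rightarrow> bool" where
  "cr_solution A b \<rho> x \<longleftrightarrow> is_arg_min (cr_obj A b \<rho>) (\<lambda>y. True) x"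

definition init_point :: "real^'n \<Rightarrow> real \<Rightarrow> real^'n" where
  "init_point b r = - ((r / norm b) *\<^sub>R b)"

primrec tr_iter :: "real^'n^'n \<Rightarrow> real^'n \<Rightarrow> real \<Rightarrow> real \<Rightarrow> real \<Rightarrow> nat \<Rightarrow> real^'n" where
  "tr_iter A b R \<eta> r 0 = init_point b r"
| "tr_iter A b R \<eta> r (Suc t) =
     closest_point (cball 0 R)
       (tr_iter A b R \<eta> r t - \<eta> *\<^sub>R (A *v tr_iter A b R \<eta> r t + b))"

primrec cr_iter :: "real^'n^'n \<Rightarrow> real^'n \<Rightarrow> real \<Rightarrow> real \<Rightarrow> real \<Rightarrow> nat \<Rightarrow> real^'n" where
  "cr_iter A b \<rho> \<eta> r 0 = init_point b r"
| "cr_iter A b \<rho> \<eta> r (Suc t) =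
     cr_iter A b \<rho> \<eta> r t -
       \<eta> *\<^sub>R (A *v cr_iter A b \<rho> \<eta> r t + b + (\<rho> * norm (cr_iter A b \<rho> \<eta> r t)) *\<^sub>R cr_iter A b \<rho> \<eta> r t)"

definition R_rho :: "real \<Rightarrow> real \<Rightarrow> real^'n \<Rightarrow> real" where
  "R_rho \<beta> \<rho> b = \<beta> / (2 * \<rho>) + sqrt ((\<beta> / (2 * \<rho>))\<^sup>2 + norm b / \<rho>)"

definition R_c :: "real^'n^'n \<Rightarrow> real^'n \<Rightarrow> real \<Rightarrow> real" where
  "R_c A b \<rho> =
     - (b \<bullet> (A *v b)) / (2 * \<rho> * (norm b)\<^sup>2)
     + sqrt (((b \<bullet> (A *v b)) / (2 * \<rho> * (norm b)\<^sup>2))\<^sup>2 + norm b / \<rho>)"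

end

theory Submission
  imports Defs
begin

text \<open>
  Both iterations have the form \<open>x\<^sub>t\<^sub>+\<^sub>1 = G x\<^sub>t\<close> with \<open>G\<close> continuous, and the step size makes the
  objective drop by at least a constant times \<open>\<parallel>x\<^sub>t\<^sub>+\<^sub>1 - x\<^sub>t\<parallel>\<^sup>2\<close> while preserving both a ball and
  the sign condition \<open>b\<^sup>(\<^sup>1\<^sup>) x\<^sup>(\<^sup>1\<^sup>) \<le> 0\<close>. So it suffices that \<open>x\<^sub>\<star>\<close> is the only fixed point satisfying
  the sign condition. A fixed point solves \<open>A x + b = - \<mu> x\<close> for some \<open>\<mu> \<ge> 0\<close>; projecting onto
  \<open>v\<^sub>1\<close> gives \<open>(\<lambda>\<^sub>1 + \<mu>) x\<^sup>(\<^sup>1\<^sup>) = - b\<^sup>(\<^sup>1\<^sup>) \<noteq> 0\<close>, so the sign condition forces \<open>\<lambda>\<^sub>1 + \<mu> > 0\<close>. Then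
  \<open>A + \<mu> I\<close> is positive definite and \<open>x\<close> is the strict global minimizer.
\<close>

section \<open>Convergence of descent iterations on a compact set\<close>

text \<open>Since \<open>f\<close> is bounded below on \<open>K\<close>, its decrements along the
  iterates tend to 0. Away from \<open>z\<close> the displacement \<open>dist (G y) y\<close> has a
  positive minimum by compactness, so an iterate there costs a fixed decrement; this can happen only
  finitely often.\<close>

lemma descent_iteration_tendsto:
  fixes x :: "nat \<Rightarrow> 'a::metric_space" and f :: "'a \<Rightarrow> real"
  assumes K: "compact K" and G: "continuous_on K G" and f: "continuous_on K f" and c: "c > 0"
    and xK: "\<And>t. x t \<in> K" and step: "\<And>t. x (Suc t) = G (x t)"
    and descent: "\<And>t. f (x (Suc t)) \<le> f (x t) - c * (dist (x (Suc t)) (x t))\<^sup>2"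
    and fixpoint: "\<And>y. y \<in> K \<Longrightarrow> G y = y \<Longrightarrow> y = z"
  shows "x \<longlonglongrightarrow> z"
proof -
  obtain m where m: "\<And>y. y \<in> K \<Longrightarrow> m \<le> f y"
    using continuous_attains_inf[OF K _ f] xK by blast
  have dec: "decseq (\<lambda>t. f (x t))"
  proof (rule decseq_SucI)
    fix t
    have "0 \<le> c * (dist (x (Suc t)) (x t))\<^sup>2" using c by simp
    then show "f (x (Suc t)) \<le> f (x t)" using descent[of t] by linarith
  qed
  then obtain L where L: "(\<lambda>t. f (x t)) \<longlonglongrightarrow> L"
    using decseq_convergent[of "\<lambda>t. f (x t)" m] m xK by blast
  have lim: "(\<lambda>t. f (x t) - f (x (Suc t))) \<longlonglongrightarrow> 0"
    using tendsto_diff[OF L LIMSEQ_Suc[OF L]] by simp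
  show ?thesis
  proof (rule tendstoI)
    fix e :: real assume e: "e > 0"
    define K' where "K' = K - ball z e"
    have K': "compact K'" unfolding K'_def using K by (intro compact_diff) auto
    show "eventually (\<lambda>t. dist (x t) z < e) sequentially"
    proof (cases "K' = {}")
      case True
      then have "x t \<in> ball z e" for t using xK[of t] by (auto simp: K'_def)
      then show ?thesis by (simp add: dist_commute)
    next
      case False
      have "continuous_on K' (\<lambda>y. dist (G y) y)"
        by (intro continuous_intros continuous_on_subset[OF G]) (auto simp: K'_def)
      then obtain w where w: "w \<in> K'" "\<And>y. y \<in> K' \<Longrightarrow> dist (G w) w \<le> dist (G y) y"
        using continuous_attains_inf[OF K' False] by blast
      have "w \<noteq> z" "w \<in> K" using w(1) e by (auto simp: K'_def)
      then have pos: "dist (G w) w > 0" using fixpoint[of w] by auto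
      then have "c * (dist (G w) w)\<^sup>2 > 0" using c by simp
      then have "eventually (\<lambda>t. f (x t) - f (x (Suc t)) < c * (dist (G w) w)\<^sup>2) sequentially"
        using order_tendstoD(2)[OF lim] by blast
      then show ?thesis
      proof (rule eventually_mono)
        fix t assume t: "f (x t) - f (x (Suc t)) < c * (dist (G w) w)\<^sup>2"
        have "c * (dist (x (Suc t)) (x t))\<^sup>2 < c * (dist (G w) w)\<^sup>2"
          using t descent[of t] by linarith
        then have "dist (x (Suc t)) (x t) < dist (G w) w"
          using c by (simp add: power2_less_imp_less)
        then have "x t \<notin> K'" using w(2)[of "x t"] by (auto simp: step)
        then show "dist (x t) z < e" using xK[of t] by (auto simp: K'_def dist_commute)
      qed
    qed
  qed
qed

section \<open>Symmetric matrices, their quadratic form and smallest eigenvalue\<close>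

lemma symmetric_inner_matrix_vector:
  fixes A :: "real^'n^'n"
  assumes "transpose A = A"
  shows "x \<bullet> (A *v y) = (A *v x) \<bullet> y"
  by (metis assms dot_lmul_matrix transpose_matrix_vector)

lemma norm_matrix_vector_le_op_norm:
  fixes A :: "real^'n^'n"
  shows "norm (A *v x) \<le> op_norm A * norm x"
  unfolding op_norm_def by (rule onorm) (rule matrix_vector_mul_bounded_linear)

lemma op_norm_nonneg: "0 \<le> op_norm A"
  unfolding op_norm_def by (rule onorm_pos_le) (rule matrix_vector_mul_bounded_linear)

text \<open>Both signs matter: the upper bound gives smoothness of the objectives, the lower one
  serves to compare \<open>R_c\<close> with \<open>R_rho\<close>.\<close>

lemma abs_quadratic_form_le:
  fixes A :: "real^'n^'n"
  assumes "op_norm A \<le> \<beta>"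
  shows "\<bar>x \<bullet> (A *v x)\<bar> \<le> \<beta> * (norm x)\<^sup>2"
proof -
  have "\<bar>x \<bullet> (A *v x)\<bar> \<le> norm x * norm (A *v x)" by (rule Cauchy_Schwarz_ineq2)
  also have "\<dots> \<le> norm x * (\<beta> * norm x)"
    by (intro mult_left_mono order_trans[OF norm_matrix_vector_le_op_norm] mult_right_mono assms) auto
  finally show ?thesis by (simp add: power2_eq_square mult_ac)
qed

text \<open>The minimum \<open>m\<close> of the form on the unit sphere is attained, and a minimizer
  \<open>v\<close> is an eigenvector for \<open>m\<close> by a variational argument; hence
  \<open>l \<le> m\<close>.\<close>

lemma smallest_eigenvalue_le_quadratic_form:
  fixes A :: "real^'n^'n"
  assumes sym: "transpose A = A" and l: "smallest_eigenvalue A l"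
  shows "l * (x \<bullet> x) \<le> x \<bullet> (A *v x)"
proof -
  have cont: "continuous_on (sphere 0 1) (\<lambda>x. x \<bullet> (A *v x))"
    by (intro continuous_intros matrix_vector_mult_linear_continuous_on)
  obtain v where v: "norm v = 1" and min: "\<And>y. norm y = 1 \<Longrightarrow> v \<bullet> (A *v v) \<le> y \<bullet> (A *v y)"
    using continuous_attains_inf[OF compact_sphere _ cont] by auto
  define m where "m = v \<bullet> (A *v v)"
  have form: "m * (y \<bullet> y) \<le> y \<bullet> (A *v y)" for y
  proof (cases "y = 0")
    case False
    have "m \<le> (y /\<^sub>R norm y) \<bullet> (A *v (y /\<^sub>R norm y))"
      unfolding m_def using False by (intro min) simp
    also have "\<dots> = (y \<bullet> (A *v y)) / (norm y)\<^sup>2"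
      by (simp add: matrix_vector_mult_scaleR power2_eq_square field_simps)
    finally show ?thesis using False by (simp add: field_simps power2_norm_eq_inner)
  qed simp
  \<comment> \<open>The residual \<open>w\<close> is the test direction: along
    \<open>v + t w\<close> the nonnegative form of \<open>A - m I\<close> is a polynomial in
    \<open>t\<close> without constant term, so its linear coefficient
    \<open>2 (w \<bullet> w)\<close> must vanish.\<close>
  define w where "w = A *v v - m *\<^sub>R v"
  define q where "q = w \<bullet> (A *v w) - m * (w \<bullet> w)"
  have q: "q \<ge> 0" using form[of w] by (simp add: q_def)
  have vv: "v \<bullet> v = 1" using v by (simp add: norm_eq_1)
  have quad: "2 * t * (w \<bullet> w) + t\<^sup>2 * q \<ge> 0" for t
  proof -
    have "0 \<le> (v + t *\<^sub>R w) \<bullet> (A *v (v + t *\<^sub>R w)) - m * ((v + t *\<^sub>R w) \<bullet> (v + t *\<^sub>R w))"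
      using form[of "v + t *\<^sub>R w"] by simp
    also have "\<dots> = (v \<bullet> (A *v v) - m * (v \<bullet> v)) + 2 * t * (w \<bullet> (A *v v) - m * (w \<bullet> v)) + t\<^sup>2 * q"
      using symmetric_inner_matrix_vector[OF sym, of v w]
      by (simp add: q_def matrix_vector_right_distrib matrix_vector_mult_scaleR inner_simps
          inner_commute power2_eq_square algebra_simps)
    also have "v \<bullet> (A *v v) - m * (v \<bullet> v) = 0" using vv by (simp add: m_def)
    also have "w \<bullet> (A *v v) - m * (w \<bullet> v) = w \<bullet> w"
    proof -
      have "w \<bullet> (A *v v) - m * (w \<bullet> v) = w \<bullet> (A *v v - m *\<^sub>R v)" by (simp add: inner_simps)
      then show ?thesis by (simp add: w_def)
    qed
    finally show ?thesis by simp
  qed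
  have "w \<bullet> w = 0"
  proof (rule ccontr)
    assume a: "w \<bullet> w \<noteq> 0"
    \<comment> \<open>A small negative \<open>t\<close> makes the polynomial negative; the
      denominator \<open>q + 1\<close> instead of \<open>q\<close> also covers
      \<open>q = 0\<close>.\<close>
    have "2 * (- (w \<bullet> w) / (q + 1)) * (w \<bullet> w) + (- (w \<bullet> w) / (q + 1))\<^sup>2 * q
        = - ((w \<bullet> w) / (q + 1))\<^sup>2 * (q + 2)"
      using q by (simp add: divide_simps power2_eq_square) algebra
    moreover have "((w \<bullet> w) / (q + 1))\<^sup>2 * (q + 2) > 0" using a q by simp
    ultimately show False using quad[of "- (w \<bullet> w) / (q + 1)"] by simp
  qed
  then have "A *v v = m *\<^sub>R v" by (simp add: w_def)
  moreover have "v \<noteq> 0" using v by auto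
  ultimately have "eigenvalue A m" unfolding eigenvalue_def by blast
  then have "l \<le> m" using l by (simp add: smallest_eigenvalue_def)
  then have "l * (x \<bullet> x) \<le> m * (x \<bullet> x)" by (simp add: mult_right_mono)
  then show ?thesis using form[of x] by linarith
qed

section \<open>The quadratic objective and its regularized stationary points\<close>

lemma tr_obj_add:
  fixes A :: "real^'n^'n"
  assumes "transpose A = A"
  shows "tr_obj A b (x + h) = tr_obj A b x + (A *v x + b) \<bullet> h + 1/2 * (h \<bullet> (A *v h))"
  using symmetric_inner_matrix_vector[OF assms, of x h]
  by (simp add: tr_obj_def matrix_vector_right_distrib inner_simps inner_commute algebra_simps)

text \<open>The sign condition makes \<open>A + \<mu> I\<close> positive definite, so the quadratic
  with the added term \<mu>/2 times the squared norm is strictly convex and stationary at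
  \<open>x\<close>. A free \<open>\<mu>\<close> serves both problems: the multiplier of the ball
  constraint, or \<open>\<rho> * norm x\<close>.\<close>

lemma stationary_point_strict_minimizer:
  fixes A :: "real^'n^'n"
  assumes sym: "transpose A = A"
    and l: "smallest_eigenvalue A l" and v: "A *v v = l *\<^sub>R v"
    and b: "v \<bullet> b \<noteq> 0" and sgn: "(v \<bullet> b) * (v \<bullet> x) \<le> 0"
    and stat: "A *v x + b = - (\<mu> *\<^sub>R x)" and "z \<noteq> x"
  shows "tr_obj A b x + \<mu>/2 * (norm x)\<^sup>2 < tr_obj A b z + \<mu>/2 * (norm z)\<^sup>2"
proof -
  have "v \<bullet> (A *v x) + v \<bullet> b = - \<mu> * (v \<bullet> x)"
    using arg_cong[OF stat, of "\<lambda>u. v \<bullet> u"] by (simp add: inner_simps)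
  then have "(l + \<mu>) * (v \<bullet> x) = - (v \<bullet> b)"
    using symmetric_inner_matrix_vector[OF sym, of v x] v by (simp add: algebra_simps)
  then have "(l + \<mu>) * ((v \<bullet> b) * (v \<bullet> x)) = - (v \<bullet> b)\<^sup>2"
    by (metis mult.left_commute mult_minus_right power2_eq_square)
  moreover have "(v \<bullet> b)\<^sup>2 > 0" using b by simp
  ultimately have "(l + \<mu>) * ((v \<bullet> b) * (v \<bullet> x)) < 0" by linarith
  then have pos: "l + \<mu> > 0" using sgn by (auto simp: mult_less_0_iff)
  define h where "h = z - x"
  have z: "z = x + h" by (simp add: h_def)
  have "0 < (l + \<mu>) * (h \<bullet> h)" using pos \<open>z \<noteq> x\<close> by (simp add: h_def)
  also have "\<dots> \<le> h \<bullet> (A *v h) + \<mu> * (h \<bullet> h)"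
    using smallest_eigenvalue_le_quadratic_form[OF sym l, of h] by (simp add: algebra_simps)
  finally have "0 < h \<bullet> (A *v h) + \<mu> * (h \<bullet> h)" .
  \<comment> \<open>Stationarity cancels the terms linear in \<open>h\<close>; half of this quantity
    is the gap between the two sides.\<close>
  then show ?thesis
    unfolding z tr_obj_add[OF sym] stat
    by (simp add: power2_norm_eq_inner inner_simps inner_commute algebra_simps)
qed

lemma tr_obj_smooth:
  fixes A :: "real^'n^'n"
  assumes "transpose A = A" and "op_norm A \<le> \<beta>"
  shows "tr_obj A b y \<le> tr_obj A b x + (A *v x + b) \<bullet> (y - x) + \<beta>/2 * (norm (y - x))\<^sup>2"
  using tr_obj_add[OF assms(1), of b x "y - x"] abs_quadratic_form_le[OF assms(2), of "y - x"]
  by simp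

lemma continuous_on_tr_obj: "continuous_on S (tr_obj A b)"
  unfolding tr_obj_def
  by (intro continuous_intros matrix_vector_mult_linear_continuous_on)

section \<open>Projection onto a ball, the initial point and the invariant set\<close>

text \<open>The explicit formula shows that projecting is scaling by a nonnegative factor. This
  preserves the sign condition and yields the multiplier at a fixed point.\<close>

lemma closest_point_cball_0:
  fixes y :: "'a::euclidean_space"
  assumes "0 < R"
  shows "closest_point (cball 0 R) y = (if norm y \<le> R then y else (R / norm y) *\<^sub>R y)"
proof (cases "norm y \<le> R")
  case True
  then show ?thesis by (simp add: closest_point_self)
next
  case False
  then have y: "norm y > R" "norm y > 0" using assms by auto
  have "dist y ((R / norm y) *\<^sub>R y) = norm ((1 - R / norm y) *\<^sub>R y)"
    by (simp add: dist_norm algebra_simps)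
  also have "\<dots> = norm y - R" using y assms by (simp add: field_simps abs_if)
  finally have d: "dist y ((R / norm y) *\<^sub>R y) = norm y - R" .
  have "(R / norm y) *\<^sub>R y = closest_point (cball 0 R) y"
  proof (rule closest_point_unique)
    show "(R / norm y) *\<^sub>R y \<in> cball 0 R" using y assms by simp
    show "\<forall>z\<in>cball 0 R. dist y ((R / norm y) *\<^sub>R y) \<le> dist y z"
    proof
      fix z :: 'a assume "z \<in> cball 0 R"
      then show "dist y ((R / norm y) *\<^sub>R y) \<le> dist y z"
        unfolding d using norm_triangle_ineq2[of y z] by (simp add: dist_norm)
    qed
  qed simp_all
  then show ?thesis using False by simp
qed

lemma norm_init_point: "b \<noteq> 0 \<Longrightarrow> 0 \<le> r \<Longrightarrow> norm (init_point b r) = r"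
  by (simp add: init_point_def)

lemma init_point_sign:
  assumes "0 \<le> r"
  shows "(v \<bullet> b) * (v \<bullet> init_point b r) \<le> 0"
proof -
  have "(v \<bullet> b) * (v \<bullet> init_point b r) = - ((r / norm b) * (v \<bullet> b)\<^sup>2)"
    by (simp add: init_point_def power2_eq_square)
  then show ?thesis using assms by simp
qed

lemma compact_signed_cball: "compact (cball 0 R \<inter> {x :: 'a::euclidean_space. (v \<bullet> b) * (v \<bullet> x) \<le> 0})"
  by (intro compact_Int_closed compact_cball closed_Collect_le continuous_intros)

lemma eigenvalue_le_op_norm:
  fixes A :: "real^'n^'n"
  assumes "norm v = 1" "A *v v = l *\<^sub>R v"
  shows "l \<le> op_norm A"
  using norm_matrix_vector_le_op_norm[of A v] assms by simp

section \<open>The trust-region problem and projected gradient descent\<close>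

lemma tr_iterates:
  fixes A :: "real^'n^'n"
  assumes sym: "transpose A = A" and v: "unit_min_eigenvector A v" and vb: "v \<bullet> b \<noteq> 0"
    and \<beta>: "op_norm A \<le> \<beta>" and R: "0 < R" and r: "0 \<le> r" "r \<le> R"
    and \<eta>: "0 < \<eta>" "\<eta> * \<beta> \<le> 1" and sol: "tr_solution A b R xstar"
  shows "tr_iter A b R \<eta> r \<longlonglongrightarrow> xstar"
    and "tr_obj A b (tr_iter A b R \<eta> r (Suc t)) \<le> tr_obj A b (tr_iter A b R \<eta> r t)"
proof -
  obtain l where v1: "norm v = 1" and l: "smallest_eigenvalue A l" and ev: "A *v v = l *\<^sub>R v"
    using v by (auto simp: unit_min_eigenvector_def)
  have b0: "b \<noteq> 0" using vb by auto
  define P where "P = (closest_point (cball 0 R) :: real^'n \<Rightarrow> real^'n)"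
  define G where "G x = P (x - \<eta> *\<^sub>R (A *v x + b))" for x
  define K where "K = cball 0 R \<inter> {x. (v \<bullet> b) * (v \<bullet> x) \<le> 0}"
  let ?x = "tr_iter A b R \<eta> r"
  have step: "?x (Suc t) = G (?x t)" for t by (simp add: G_def P_def)
  \<comment> \<open>A gradient step multiplies the component along \<open>v\<close> by
    \<open>1 - \<eta> * l\<close> before subtracting \<open>\<eta> * (v \<bullet> b)\<close>; a
    nonnegative factor keeps the sign.\<close>
  have \<eta>l: "\<eta> * l \<le> 1"
    using eigenvalue_le_op_norm[OF v1 ev] \<beta> \<eta> mult_left_mono[of l \<beta> \<eta>] by linarith
  have P: "P y = y \<or> (norm y > R \<and> P y = (R / norm y) *\<^sub>R y)" for y
    using closest_point_cball_0[OF R, of y] by (auto simp: P_def)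
  have P_ball: "P y \<in> cball 0 R" for y
    unfolding P_def using R by (intro closest_point_in_set) auto
  have G_K: "G x \<in> K" if "x \<in> K" for x
  proof -
    let ?y = "x - \<eta> *\<^sub>R (A *v x + b)"
    have eq: "v \<bullet> ?y = (1 - \<eta> * l) * (v \<bullet> x) - \<eta> * (v \<bullet> b)"
      using symmetric_inner_matrix_vector[OF sym, of v x] ev
      by (simp add: inner_simps algebra_simps)
    have "(v \<bullet> b) * (v \<bullet> ?y) = (1 - \<eta> * l) * ((v \<bullet> b) * (v \<bullet> x)) - \<eta> * (v \<bullet> b)\<^sup>2"
      unfolding eq by (simp add: power2_eq_square algebra_simps)
    moreover have "(1 - \<eta> * l) * ((v \<bullet> b) * (v \<bullet> x)) \<le> 0"
      by (rule mult_nonneg_nonpos) (use that \<eta>l in \<open>simp_all add: K_def\<close>)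
    moreover have "\<eta> * (v \<bullet> b)\<^sup>2 \<ge> 0" using \<eta> by simp
    ultimately have y: "(v \<bullet> b) * (v \<bullet> ?y) \<le> 0" by linarith
    obtain c where c: "c \<ge> 0" "P ?y = c *\<^sub>R ?y"
    proof -
      have "0 \<le> R / norm ?y" using R by simp
      then show ?thesis using that[of 1] that[of "R / norm ?y"] P[of ?y] by auto
    qed
    have "(v \<bullet> b) * (v \<bullet> P ?y) = c * ((v \<bullet> b) * (v \<bullet> ?y))"
      unfolding c(2) by simp
    also have "\<dots> \<le> 0" using c(1) y by (rule mult_nonneg_nonpos)
    finally show ?thesis using P_ball[of ?y] by (simp add: K_def G_def)
  qed
  have xK: "?x t \<in> K" for t
  proof (induction t)
    case 0
    show ?case using norm_init_point[OF b0 r(1)] init_point_sign[OF r(1), of v b] r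
      by (simp add: K_def)
  next
    case (Suc t)
    then show ?case unfolding step by (rule G_K)
  qed
  have descent: "tr_obj A b (G x) \<le> tr_obj A b x - 1 / (2 * \<eta>) * (dist (G x) x)\<^sup>2" if "x \<in> K" for x
  proof -
    let ?g = "A *v x + b"
    \<comment> \<open>Obtuse-angle property of the projection, tested at \<open>x\<close>, which
      lies in the ball. It bounds the linear term by -1/\<eta> times the squared displacement;
      smoothness with \<open>\<beta> \<le> 1 / \<eta>\<close> gives back at most half of
      that.\<close>
    have "((x - \<eta> *\<^sub>R ?g) - G x) \<bullet> (x - G x) \<le> 0"
      unfolding G_def P_def using that by (intro closest_point_dot) (auto simp: K_def)
    then have "(norm (G x - x))\<^sup>2 + \<eta> * (?g \<bullet> (G x - x)) \<le> 0"
      by (simp add: power2_norm_eq_inner inner_simps inner_commute algebra_simps)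
    then have g: "?g \<bullet> (G x - x) \<le> - (1 / \<eta>) * (norm (G x - x))\<^sup>2"
      using \<eta>(1) by (simp add: field_simps)
    have "\<beta> \<le> 1 / \<eta>" using \<eta> by (simp add: field_simps)
    then have "\<beta>/2 * (norm (G x - x))\<^sup>2 \<le> (1 / \<eta>)/2 * (norm (G x - x))\<^sup>2"
      by (intro mult_right_mono) auto
    then show ?thesis
      using tr_obj_smooth[OF sym \<beta>, of b "G x" x] g by (simp add: dist_norm)
  qed
  show "tr_obj A b (?x (Suc t)) \<le> tr_obj A b (?x t)"
  proof -
    have "0 \<le> 1 / (2 * \<eta>) * (dist (G (?x t)) (?x t))\<^sup>2" using \<eta> by simp
    then show ?thesis using descent[OF xK[of t]] unfolding step by linarith
  qed
  show "?x \<longlonglongrightarrow> xstar"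
  proof (rule descent_iteration_tendsto[where K = K and G = G and f = "tr_obj A b" and c = "1 / (2 * \<eta>)"])
    show "compact K" unfolding K_def by (rule compact_signed_cball)
    have "continuous_on UNIV (\<lambda>x. P (x - \<eta> *\<^sub>R (A *v x + b)))"
    proof (rule continuous_on_compose2[where t = UNIV and g = P])
      show "continuous_on UNIV P"
        unfolding P_def using R by (intro continuous_on_closest_point) auto
    qed (auto intro!: continuous_intros matrix_vector_mult_linear_continuous_on)
    then show "continuous_on K G" unfolding G_def[abs_def] by (rule continuous_on_subset) simp
    show "continuous_on K (tr_obj A b)" by (rule continuous_on_tr_obj)
    show "1 / (2 * \<eta>) > 0" using \<eta> by simp
    show "?x t \<in> K" for t by (rule xK)
    show "?x (Suc t) = G (?x t)" for t by (rule step)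
    show "tr_obj A b (?x (Suc t)) \<le> tr_obj A b (?x t) - 1 / (2 * \<eta>) * (dist (?x (Suc t)) (?x t))\<^sup>2" for t
      unfolding step by (rule descent) (rule xK)
  next
    fix x assume x: "x \<in> K" "G x = x"
    let ?y = "x - \<eta> *\<^sub>R (A *v x + b)"
    \<comment> \<open>The optimality conditions with complementary slackness. When the projection
      moves \<open>?y\<close>, the fixed point equation reads \<open>?y = c *\<^sub>R x\<close> with
      \<open>c > 1\<close>, so the multiplier is \<open>(c - 1) / \<eta>\<close>.\<close>
    obtain \<mu> where \<mu>: "\<mu> \<ge> 0" "A *v x + b = - (\<mu> *\<^sub>R x)" "\<mu> = 0 \<or> norm x = R"
    proof (cases "P ?y = ?y")
      case True
      then have "A *v x + b = 0" using x(2) \<eta> by (simp add: G_def)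
      then show ?thesis using that[of 0] by simp
    next
      case False
      then have y: "norm ?y > R" "x = (R / norm ?y) *\<^sub>R ?y"
        using P[of ?y] x(2) by (auto simp: G_def)
      define c where "c = norm ?y / R"
      have c: "c > 1" using y(1) R by (simp add: c_def)
      have y0: "norm ?y \<noteq> 0" using y(1) R by linarith
      have "c *\<^sub>R x = (c * (R / norm ?y)) *\<^sub>R ?y" using y(2) by (metis scaleR_scaleR)
      also have "c * (R / norm ?y) = 1" using y0 R by (simp add: c_def)
      finally have "\<eta> *\<^sub>R (A *v x + b) = - ((c - 1) *\<^sub>R x)" by (simp add: algebra_simps)
      then have "(1 / \<eta>) *\<^sub>R \<eta> *\<^sub>R (A *v x + b) = (1 / \<eta>) *\<^sub>R (- ((c - 1) *\<^sub>R x))" by simp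
      then have "A *v x + b = - (((c - 1) / \<eta>) *\<^sub>R x)" using \<eta> by simp
      moreover have "norm x = R"
      proof -
        have "norm x = norm ((R / norm ?y) *\<^sub>R ?y)" using y(2) by simp
        also have "\<dots> = (R / norm ?y) * norm ?y" using R by simp
        finally show ?thesis using y0 by simp
      qed
      ultimately show ?thesis using that[of "(c - 1) / \<eta>"] c \<eta> by simp
    qed
    show "x = xstar"
    proof (rule ccontr)
      assume "x \<noteq> xstar"
      then have *: "tr_obj A b x + \<mu>/2 * (norm x)\<^sup>2 < tr_obj A b xstar + \<mu>/2 * (norm xstar)\<^sup>2"
        using stationary_point_strict_minimizer[OF sym l ev vb _ \<mu>(2), of xstar] x(1)
        by (simp add: K_def)
      have xs: "norm xstar \<le> R" using sol by (simp add: tr_solution_def is_arg_min_def)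
      then have "\<mu>/2 * (norm xstar)\<^sup>2 \<le> \<mu>/2 * (norm x)\<^sup>2"
        using \<mu>(1,3) by (cases "\<mu> = 0") (auto intro!: mult_left_mono power_mono)
      then have "tr_obj A b x < tr_obj A b xstar" using * by linarith
      then show False
        using sol x(1) by (auto simp: tr_solution_def is_arg_min_def K_def)
    qed
  qed
qed

section \<open>The cubic-regularized problem and gradient descent\<close>

text \<open>The left side is the error of the tangent at \<open>s\<^sup>2\<close> when the cube is
  viewed as a function of the square. For nonnegative \<open>s\<close> and \<open>u\<close> the
  factored form gives an upper bound for smoothness and nonnegativity for optimality.\<close>

lemma cubic_remainder:
  fixes s u :: real
  shows "u^3 - s^3 - 3/2 * s * (u\<^sup>2 - s\<^sup>2) = (u - s)\<^sup>2 * (u + s/2)"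
  by (simp add: power2_eq_square power3_eq_cube field_simps)

lemma cr_obj_smooth:
  fixes A :: "real^'n^'n"
  assumes "transpose A = A" and "op_norm A \<le> \<beta>" and \<rho>: "0 < \<rho>"
    and x: "norm x \<le> R" and y: "norm y \<le> R"
  shows "cr_obj A b \<rho> y \<le> cr_obj A b \<rho> x + (A *v x + b + (\<rho> * norm x) *\<^sub>R x) \<bullet> (y - x)
           + (\<beta>/2 + \<rho> * R) * (norm (y - x))\<^sup>2"
proof -
  let ?n = "(norm (y - x))\<^sup>2"
  \<comment> \<open>Polarization turns the linear term into squared norms, to which
    \<open>cubic_remainder\<close> applies.\<close>
  have xh: "x \<bullet> (y - x) = ((norm y)\<^sup>2 - (norm x)\<^sup>2 - ?n) / 2"
    by (simp add: power2_norm_eq_inner inner_simps inner_commute)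
  have "norm y ^ 3 - norm x ^ 3 - 3 * norm x * (x \<bullet> (y - x))
      = (norm y - norm x)\<^sup>2 * (norm y + norm x / 2) + 3/2 * norm x * ?n"
    unfolding xh cubic_remainder[symmetric] by (simp add: algebra_simps add_divide_distrib diff_divide_distrib)
  also have "(norm y - norm x)\<^sup>2 * (norm y + norm x / 2) \<le> ?n * (norm y + norm x / 2)"
  proof (rule mult_right_mono)
    show "(norm y - norm x)\<^sup>2 \<le> ?n"
      using norm_triangle_ineq3[of y x] by (metis abs_norm_cancel abs_le_square_iff)
  qed simp
  also have "?n * (norm y + norm x / 2) + 3/2 * norm x * ?n = (norm y + 2 * norm x) * ?n"
    by (simp add: algebra_simps)
  also have "\<dots> \<le> (3 * R) * ?n" using x y by (intro mult_right_mono) auto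
  finally have "norm y ^ 3 - norm x ^ 3 - 3 * norm x * (x \<bullet> (y - x)) \<le> 3 * R * ?n" by simp
  then have "\<rho>/3 * (norm y ^ 3 - norm x ^ 3 - 3 * norm x * (x \<bullet> (y - x))) \<le> \<rho>/3 * (3 * R * ?n)"
    using \<rho> by (intro mult_left_mono) auto
  then have "\<rho>/3 * norm y ^ 3 \<le> \<rho>/3 * norm x ^ 3 + (\<rho> * norm x) * (x \<bullet> (y - x)) + \<rho> * R * ?n"
    by (simp add: algebra_simps)
  moreover have "cr_obj A b \<rho> w = tr_obj A b w + \<rho>/3 * norm w ^ 3" for w
    by (simp add: cr_obj_def tr_obj_def)
  ultimately show ?thesis
    using tr_obj_smooth[OF assms(1,2), of b y x]
    by (simp add: inner_add_left distrib_right)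
qed

text \<open>As the norm of the pair \<open>(p, sqrt q)\<close>, the root is 1-Lipschitz in
  \<open>p\<close>, so it cannot lose more than the summand \<open>p\<close> gains, whatever the
  signs.\<close>

lemma add_sqrt_square_mono:
  fixes p p' q :: real
  assumes "p \<le> p'" and "0 \<le> q"
  shows "p + sqrt (p\<^sup>2 + q) \<le> p' + sqrt (p'\<^sup>2 + q)"
proof -
  have "norm (p, sqrt q) \<le> norm (p', sqrt q) + norm ((p, sqrt q) - (p', sqrt q))"
    by (metis norm_triangle_sub add.commute)
  then have "sqrt (p\<^sup>2 + q) \<le> sqrt (p'\<^sup>2 + q) + \<bar>p - p'\<bar>"
    using assms(2) by (simp add: norm_Pair)
  then show ?thesis using assms(1) by linarith
qed

text \<open>Places the initial point in the ball of radius \<open>R_rho\<close>. Both radii are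
  values of the monotone function in \<open>add_sqrt_square_mono\<close>.\<close>

lemma R_c_le_R_rho:
  fixes A :: "real^'n^'n"
  assumes \<beta>: "op_norm A \<le> \<beta>" and \<rho>: "0 < \<rho>" and b: "b \<noteq> 0"
  shows "R_c A b \<rho> \<le> R_rho \<beta> \<rho> b"
proof -
  define p where "p = - (b \<bullet> (A *v b)) / (2 * \<rho> * (norm b)\<^sup>2)"
  have "- (b \<bullet> (A *v b)) \<le> \<beta> * (norm b)\<^sup>2"
    using abs_quadratic_form_le[OF \<beta>, of b] by linarith
  then have "p \<le> \<beta> / (2 * \<rho>)"
    unfolding p_def using \<rho> b by (simp add: field_simps)
  then have "p + sqrt (p\<^sup>2 + norm b / \<rho>) \<le> R_rho \<beta> \<rho> b"
    unfolding R_rho_def using \<rho> by (intro add_sqrt_square_mono) auto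
  then show ?thesis by (simp add: R_c_def p_def)
qed

text \<open>\<open>R_rho\<close> is the positive root of a quadratic equation, which is what makes
  its ball invariant under the cubic iteration.\<close>

lemma R_rho_root:
  assumes "0 < \<rho>" and "0 \<le> \<beta>" and "b \<noteq> 0"
  shows "R_rho \<beta> \<rho> b > 0"
    and "\<rho> * (R_rho \<beta> \<rho> b)\<^sup>2 = \<beta> * R_rho \<beta> \<rho> b + norm b"
proof -
  define p where "p = \<beta> / (2 * \<rho>)"
  define s where "s = sqrt (p\<^sup>2 + norm b / \<rho>)"
  have R: "R_rho \<beta> \<rho> b = p + s" by (simp add: R_rho_def p_def s_def)
  have nb: "norm b / \<rho> > 0" using assms by simp
  then have "p\<^sup>2 + norm b / \<rho> > 0" by (simp add: add_nonneg_pos)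
  then have s: "s > 0" "s\<^sup>2 = p\<^sup>2 + norm b / \<rho>" by (auto simp: s_def)
  show "R_rho \<beta> \<rho> b > 0" using s(1) assms by (simp add: R p_def add_nonneg_pos)
  have "\<beta> = 2 * \<rho> * p" using assms by (simp add: p_def)
  moreover have "\<rho> * s\<^sup>2 = \<rho> * p\<^sup>2 + norm b" using assms by (simp add: s(2) field_simps)
  ultimately show "\<rho> * (R_rho \<beta> \<rho> b)\<^sup>2 = \<beta> * R_rho \<beta> \<rho> b + norm b"
    unfolding R by (simp add: power2_eq_square algebra_simps)
qed

lemma cr_iterates:
  fixes A :: "real^'n^'n"
  assumes sym: "transpose A = A" and v: "unit_min_eigenvector A v" and vb: "v \<bullet> b \<noteq> 0"
    and \<beta>: "op_norm A \<le> \<beta>" and \<rho>: "0 < \<rho>" and r: "0 \<le> r" "r \<le> R_c A b \<rho>"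
    and \<eta>: "0 < \<eta>" "\<eta> \<le> 1 / (4 * (\<beta> + \<rho> * R_rho \<beta> \<rho> b))" and sol: "cr_solution A b \<rho> xstar"
  shows "cr_iter A b \<rho> \<eta> r \<longlonglongrightarrow> xstar"
    and "cr_obj A b \<rho> (cr_iter A b \<rho> \<eta> r (Suc t)) \<le> cr_obj A b \<rho> (cr_iter A b \<rho> \<eta> r t)"
proof -
  obtain l where v1: "norm v = 1" and l: "smallest_eigenvalue A l" and ev: "A *v v = l *\<^sub>R v"
    using v by (auto simp: unit_min_eigenvector_def)
  have b0: "b \<noteq> 0" using vb by auto
  have \<beta>0: "0 \<le> \<beta>" using op_norm_nonneg[of A] \<beta> by linarith
  define R where "R = R_rho \<beta> \<rho> b"
  have R: "R > 0" "\<rho> * R\<^sup>2 = \<beta> * R + norm b"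
    using R_rho_root[OF \<rho> \<beta>0 b0] by (auto simp: R_def)
  have rR: "r \<le> R" using r(2) R_c_le_R_rho[OF \<beta> \<rho> b0] by (simp add: R_def)
  have "\<rho> * R > 0" using \<rho> R by simp
  then have L: "\<beta> + \<rho> * R > 0" using \<beta>0 by linarith
  then have \<eta>L: "4 * (\<eta> * (\<beta> + \<rho> * R)) \<le> 1" using \<eta>(2) by (simp add: R_def field_simps)
  define G where "G x = x - \<eta> *\<^sub>R (A *v x + b + (\<rho> * norm x) *\<^sub>R x)" for x
  define K where "K = cball 0 R \<inter> {x. (v \<bullet> b) * (v \<bullet> x) \<le> 0}"
  let ?x = "cr_iter A b \<rho> \<eta> r"
  have step: "?x (Suc t) = G (?x t)" for t by (simp add: G_def)
  have \<eta>s: "\<eta> * \<beta> + \<eta> * \<rho> * s \<le> 1/4" "\<eta> * \<rho> * s \<le> 1/4" if "s \<le> R" for s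
  proof -
    have "\<eta> * \<rho> * s \<le> \<eta> * \<rho> * R" using that \<eta> \<rho> by (intro mult_left_mono) auto
    moreover have "4 * (\<eta> * \<beta>) + 4 * (\<eta> * \<rho> * R) \<le> 1" using \<eta>L by (simp add: algebra_simps)
    moreover have "\<eta> * \<beta> \<ge> 0" using \<eta> \<beta>0 by simp
    ultimately show "\<eta> * \<beta> + \<eta> * \<rho> * s \<le> 1/4" "\<eta> * \<rho> * s \<le> 1/4" by linarith+
  qed
  \<comment> \<open>\<open>\<parallel>G x\<parallel> \<le> \<phi>(\<parallel>x\<parallel>)\<close> with \<open>\<phi>(s) = s - \<eta>(\<rho> s\<^sup>2 - \<beta> s - \<parallel>b\<parallel>)\<close>, which increases on \<open>[0, R]\<close> and fixes \<open>R\<close>.\<close>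
  have G_ball: "norm (G x) \<le> R" if "norm x \<le> R" for x
  proof -
    define s where "s = norm x"
    have s: "0 \<le> s" "s \<le> R" using that by (auto simp: s_def)
    have "norm (G x) = norm ((1 - \<eta> * \<rho> * s) *\<^sub>R x - \<eta> *\<^sub>R (A *v x) - \<eta> *\<^sub>R b)"
      by (simp add: G_def s_def algebra_simps)
    also have "\<dots> \<le> norm ((1 - \<eta> * \<rho> * s) *\<^sub>R x) + norm (\<eta> *\<^sub>R (A *v x)) + norm (\<eta> *\<^sub>R b)"
      by (intro norm_triangle_le_diff add_right_mono norm_triangle_ineq4)
    also have "\<dots> \<le> (1 - \<eta> * \<rho> * s) * s + \<eta> * (\<beta> * s) + \<eta> * norm b"
    proof (intro add_mono)
      have "norm (A *v x) \<le> \<beta> * s"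
        using norm_matrix_vector_le_op_norm[of A x] \<beta> mult_right_mono[OF \<beta>, of s] s
        by (simp add: s_def)
      then show "norm (\<eta> *\<^sub>R (A *v x)) \<le> \<eta> * (\<beta> * s)" using \<eta> by simp
    qed (use \<eta> \<eta>s(2)[OF s(2)] in \<open>auto simp: s_def\<close>)
    \<comment> \<open>Expansion around \<open>s = R\<close>: the last summand vanishes by the root
      equation, and the factor of \<open>R - s\<close> is nonnegative for this step size.\<close>
    also have "\<dots> = R - (R - s) * (1 + \<eta> * \<beta> - \<eta> * \<rho> * s - \<eta> * \<rho> * R)
        + \<eta> * (\<beta> * R + norm b - \<rho> * R\<^sup>2)"
      by (simp add: algebra_simps power2_eq_square)
    also have "\<dots> = R - (R - s) * (1 + \<eta> * \<beta> - \<eta> * \<rho> * s - \<eta> * \<rho> * R)"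
      using R(2) by simp
    also have "\<dots> \<le> R"
    proof -
      have "0 \<le> \<eta> * \<beta>" using \<eta> \<beta>0 by simp
      then have "0 \<le> 1 + \<eta> * \<beta> - \<eta> * \<rho> * s - \<eta> * \<rho> * R"
        using \<eta>s(2)[OF s(2)] \<eta>s(2)[of R] by linarith
      then have "0 \<le> (R - s) * (1 + \<eta> * \<beta> - \<eta> * \<rho> * s - \<eta> * \<rho> * R)" using s by simp
      then show ?thesis by linarith
    qed
    finally show ?thesis .
  qed
  have G_K: "G x \<in> K" if "x \<in> K" for x
  proof -
    have x: "norm x \<le> R" "(v \<bullet> b) * (v \<bullet> x) \<le> 0" using that by (auto simp: K_def)
    have eq: "v \<bullet> G x = (1 - \<eta> * l - \<eta> * \<rho> * norm x) * (v \<bullet> x) - \<eta> * (v \<bullet> b)"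
      using symmetric_inner_matrix_vector[OF sym, of v x] ev
      by (simp add: G_def inner_simps algebra_simps)
    have "(v \<bullet> b) * (v \<bullet> G x)
        = (1 - \<eta> * l - \<eta> * \<rho> * norm x) * ((v \<bullet> b) * (v \<bullet> x)) - \<eta> * (v \<bullet> b)\<^sup>2"
      unfolding eq by (simp add: power2_eq_square algebra_simps)
    moreover have "(1 - \<eta> * l - \<eta> * \<rho> * norm x) * ((v \<bullet> b) * (v \<bullet> x)) \<le> 0"
    proof (rule mult_nonneg_nonpos)
      have "\<eta> * l \<le> \<eta> * \<beta>"
        using eigenvalue_le_op_norm[OF v1 ev] \<beta> \<eta> by (intro mult_left_mono) auto
      then show "0 \<le> 1 - \<eta> * l - \<eta> * \<rho> * norm x" using \<eta>s(1)[OF x(1)] by linarith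
    qed (rule x)
    moreover have "\<eta> * (v \<bullet> b)\<^sup>2 \<ge> 0" using \<eta> by simp
    ultimately have "(v \<bullet> b) * (v \<bullet> G x) \<le> 0" by linarith
    then show ?thesis using G_ball[OF x(1)] by (simp add: K_def)
  qed
  have xK: "?x t \<in> K" for t
  proof (induction t)
    case 0
    show ?case using norm_init_point[OF b0 r(1)] init_point_sign[OF r(1), of v b] rR
      by (simp add: K_def)
  next
    case (Suc t)
    then show ?case unfolding step by (rule G_K)
  qed
  have descent: "cr_obj A b \<rho> (G x) \<le> cr_obj A b \<rho> x - 1 / (2 * \<eta>) * (dist (G x) x)\<^sup>2" if "x \<in> K" for x
  proof -
    let ?g = "A *v x + b + (\<rho> * norm x) *\<^sub>R x"
    have x: "norm x \<le> R" "norm (G x) \<le> R" using that G_K[OF that] by (auto simp: K_def)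
    have h: "G x - x = - (\<eta> *\<^sub>R ?g)" by (simp add: G_def)
    have "?g \<bullet> (G x - x) = - (1 / \<eta>) * (norm (G x - x))\<^sup>2"
      unfolding h using \<eta>(1) by (simp add: dot_square_norm power2_eq_square)
    moreover have "\<beta>/2 + \<rho> * R \<le> (1 / \<eta>)/2"
    proof -
      \<comment> \<open>The 4 in the step size bound says exactly that
        \<open>2 * (\<beta> + \<rho> * R)\<close> is at most \<open>(1 / \<eta>)/2\<close>.\<close>
      have "\<beta>/2 + \<rho> * R \<le> 2 * (\<beta> + \<rho> * R)" using \<beta>0 \<open>\<rho> * R > 0\<close> by argo
      also have "\<dots> \<le> (1 / \<eta>)/2" using \<eta>L \<eta> by (simp add: field_simps)
      finally show ?thesis .
    qed
    then have "(\<beta>/2 + \<rho> * R) * (norm (G x - x))\<^sup>2 \<le> (1 / \<eta>)/2 * (norm (G x - x))\<^sup>2"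
      by (intro mult_right_mono) auto
    ultimately show ?thesis
      using cr_obj_smooth[OF sym \<beta> \<rho> x, of b] by (simp add: dist_norm)
  qed
  show "cr_obj A b \<rho> (?x (Suc t)) \<le> cr_obj A b \<rho> (?x t)"
  proof -
    have "0 \<le> 1 / (2 * \<eta>) * (dist (G (?x t)) (?x t))\<^sup>2" using \<eta> by simp
    then show ?thesis using descent[OF xK[of t]] unfolding step by linarith
  qed
  show "?x \<longlonglongrightarrow> xstar"
  proof (rule descent_iteration_tendsto[where K = K and G = G and f = "cr_obj A b \<rho>" and c = "1 / (2 * \<eta>)"])
    show "compact K" unfolding K_def by (rule compact_signed_cball)
    show "continuous_on K G" unfolding G_def[abs_def]
      by (intro continuous_intros matrix_vector_mult_linear_continuous_on)
    show "continuous_on K (cr_obj A b \<rho>)" unfolding cr_obj_def[abs_def]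
      by (intro continuous_intros matrix_vector_mult_linear_continuous_on)
    show "1 / (2 * \<eta>) > 0" using \<eta> by simp
    show "?x t \<in> K" for t by (rule xK)
    show "?x (Suc t) = G (?x t)" for t by (rule step)
    show "cr_obj A b \<rho> (?x (Suc t)) \<le> cr_obj A b \<rho> (?x t) - 1 / (2 * \<eta>) * (dist (?x (Suc t)) (?x t))\<^sup>2" for t
      unfolding step by (rule descent) (rule xK)
  next
    fix x assume x: "x \<in> K" "G x = x"
    have stat: "A *v x + b = - ((\<rho> * norm x) *\<^sub>R x)"
      using x(2) \<eta> by (simp add: G_def eq_neg_iff_add_eq_0)
    show "x = xstar"
    proof (rule ccontr)
      assume "x \<noteq> xstar"
      then have "tr_obj A b x + (\<rho> * norm x)/2 * (norm x)\<^sup>2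
          < tr_obj A b xstar + (\<rho> * norm x)/2 * (norm xstar)\<^sup>2"
        using stationary_point_strict_minimizer[OF sym l ev vb _ stat, of xstar] x(1)
        by (simp add: K_def)
      \<comment> \<open>The cubic term lies above its tangent in the squared norm at
        \<open>x\<close>, so the strict inequality for the quadratic regularizer passes to the cubic
        one.\<close>
      moreover have "0 \<le> \<rho>/3 * ((norm xstar - norm x)\<^sup>2 * (norm xstar + norm x/2))"
        using \<rho> by simp
      then have "(\<rho> * norm x)/2 * (norm xstar)\<^sup>2 - (\<rho> * norm x)/2 * (norm x)\<^sup>2
          \<le> \<rho>/3 * norm xstar ^ 3 - \<rho>/3 * norm x ^ 3"
        unfolding cubic_remainder[symmetric] by (simp add: algebra_simps)
      ultimately have "cr_obj A b \<rho> x < cr_obj A b \<rho> xstar"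
        by (simp add: cr_obj_def tr_obj_def)
      then show False using sol by (auto simp: cr_solution_def is_arg_min_def)
    qed
  qed
qed

theorem proposition3p1:
  fixes A :: "real^'n^'n" and b v1 :: "real^'n" and \<beta> :: real
  assumes "transpose A = A"
    and "unit_min_eigenvector A v1"
    and "v1 \<bullet> b \<noteq> 0"
    and "\<beta> \<ge> op_norm A"
  shows "(\<forall>(R::real) (r::real) (\<eta>::real) (xstar::real^'n).
            R > 0 \<and> 0 \<le> r \<and> r \<le> R \<and> 0 < \<eta> \<and> (\<beta> \<noteq> 0 \<longrightarrow> \<eta> \<le> 1 / \<beta>) \<and>
            tr_solution A b R xstar \<longrightarrow>
              (tr_iter A b R \<eta> r \<longlonglongrightarrow> xstar) \<and>
              (\<forall>t. tr_obj A b (tr_iter A b R \<eta> r (Suc t)) \<le> tr_obj A b (tr_iter A b R \<eta> r t))) \<and>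
         (\<forall>(\<rho>::real) (r::real) (\<eta>::real) (xstar::real^'n).
            \<rho> > 0 \<and> 0 \<le> r \<and> r \<le> R_c A b \<rho> \<and> 0 < \<eta> \<and> \<eta> \<le> 1 / (4 * (\<beta> + \<rho> * R_rho \<beta> \<rho> b)) \<and>
            cr_solution A b \<rho> xstar \<longrightarrow>
              (cr_iter A b \<rho> \<eta> r \<longlonglongrightarrow> xstar) \<and>
              (\<forall>t. cr_obj A b \<rho> (cr_iter A b \<rho> \<eta> r (Suc t)) \<le> cr_obj A b \<rho> (cr_iter A b \<rho> \<eta> r t)))"
proof (intro conjI allI impI; (elim conjE)?)
  fix R r \<eta> :: real and xstar :: "real^'n" and t
  assume h: "R > 0" "0 \<le> r" "r \<le> R" "0 < \<eta>" "\<beta> \<noteq> 0 \<longrightarrow> \<eta> \<le> 1 / \<beta>" "tr_solution A b R xstar"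
  have "\<beta> \<ge> 0" using op_norm_nonneg[of A] assms(4) by linarith
  \<comment> \<open>The product form also covers \<open>\<beta> = 0\<close>, where 1/\<beta> is read
    as infinity and every positive step is allowed.\<close>
  then have "\<eta> * \<beta> \<le> 1" using h(5) by (cases "\<beta> = 0") (auto simp: field_simps)
  note tr = tr_iterates[OF assms(1-4) h(1-4) this h(6)]
  show "tr_iter A b R \<eta> r \<longlonglongrightarrow> xstar" by (rule tr(1))
  show "tr_obj A b (tr_iter A b R \<eta> r (Suc t)) \<le> tr_obj A b (tr_iter A b R \<eta> r t)" by (rule tr(2))
next
  fix \<rho> r \<eta> :: real and xstar :: "real^'n" and t
  assume h: "\<rho> > 0" "0 \<le> r" "r \<le> R_c A b \<rho>" "0 < \<eta>"
    "\<eta> \<le> 1 / (4 * (\<beta> + \<rho> * R_rho \<beta> \<rho> b))" "cr_solution A b \<rho> xstar"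
  note cr = cr_iterates[OF assms(1-4) h]
  show "cr_iter A b \<rho> \<eta> r \<longlonglongrightarrow> xstar" by (rule cr(1))
  show "cr_obj A b \<rho> (cr_iter A b \<rho> \<eta> r (Suc t)) \<le> cr_obj A b \<rho> (cr_iter A b \<rho> \<eta> r t)" by (rule cr(2))
qed

end
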